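(* Let $\lambda$ be a nonzero real number. For every integer $n \geq 1$, \[ b_{n,\lambda}(x)=\sum_{l=0}^{n-1}\lambda^l\binom{n-1}{l}B_l^{(n)}\,b_{n-l}(x)=\sum_{l=0}^n\sum_{m=0}^{n-l}\lambda^l\binom{n-1}{l}\binom{n-l}{m}B_l^{(n)}\,b_m\,x^{n-l-m}. \]
   Context: For a nonzero real $\lambda$, the degenerate ordered Bell polynomials $b_{n,\lambda}(x)$ are defined by the formal power series identity \[ \frac{1}{2-(1+\lambda t)^{1/\lambda}}(1+\lambda t)^{x/\lambda}=\sum_{n=0}^\infty b_{n,\lambda}(x)\frac{t^n}{n!}, \] where $(1+\lambda t)^{a/\lambda}=\exp\big(\tfrac{a}{\lambda}\log(1+\lambda t)\big)$. The (ordinary) ordered Bell polynomials $b_n(x)$ are defined by $\frac{1}{2-e^t}e^{xt}=\sum_{n\ge 0}b_n(x)\frac{t^n}{n!}$, and $b_n=b_n(0)$ are the ordered Bell numbers. The higher-order Bernoulli numbers $B_n^{(\alpha)}$ are defined by $\left(\frac{t}{e^t-1}\right)^\alpha=\sum_{n\ge0}B_n^{(\alpha)}\frac{t^n}{n!}$. *)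

theory Defs
  imports Complex_Main "HOL-Computational_Algebra.Formal_Power_Series"
begin

text \<open>The series \<open>(1 + lam t)^(a / lam) = exp ((a / lam) log (1 + lam t))\<close>. Note that
  \<open>fps_ln 1\<close> is \<open>log (1 + t)\<close> and that both compositions are with series without constant term.\<close>

definition degenerate_exp_fps :: "real \<Rightarrow> real \<Rightarrow> real fps" where
  "degenerate_exp_fps lam a =
     fps_exp 1 oo (fps_const (a / lam) * (fps_ln 1 oo (fps_const lam * fps_X)))"

definition degenerate_ordered_bell :: "real \<Rightarrow> nat \<Rightarrow> real \<Rightarrow> real" where
  "degenerate_ordered_bell lam n x =
     fact n * fps_nth (1 / (2 - degenerate_exp_fps lam 1) * degenerate_exp_fps lam x) n"

definition ordered_bell_poly :: "nat \<Rightarrow> real \<Rightarrow> real" where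
  "ordered_bell_poly n x = fact n * fps_nth (1 / (2 - fps_exp 1) * fps_exp x) n"

definition ordered_bell_number :: "nat \<Rightarrow> real" where
  "ordered_bell_number n = ordered_bell_poly n 0"

text \<open>The order \<open>k\<close> is a natural number, so the power is the ordinary one. The denominator
  has zero constant term; division of formal power series cancels the common factor \<open>t\<close>.\<close>

definition higher_bernoulli :: "nat \<Rightarrow> nat \<Rightarrow> real" where
  "higher_bernoulli k n = fact n * fps_nth ((fps_X / (fps_exp 1 - 1)) ^ k) n"

end

theory Submission
  imports Defs
begin

unbundle fps_syntax

text \<open>With \<open>L(t) = log (1 + lam t) / lam\<close>, the generating function of the degenerate polynomials is
  \<open>F(L(t))\<close>, where \<open>F(u) = exp (x u) / (2 - exp u)\<close> generates the ordinary ones. The compositional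
  inverse of \<open>L\<close> is \<open>G(u) = (exp (lam u) - 1) / lam\<close>, so Lagrange inversion gives
  \<open>n [t^n] F(L(t)) = [u^(n-1)] F'(u) (u / G(u))^n\<close>, and the coefficient of \<open>u^l\<close> in \<open>(u / G(u))^n\<close>
  is \<open>lam^l B_l^(n) / l!\<close>.\<close>

text \<open>Read in Laurent series, the left-hand side is the residue of \<open>G^(k-n-1) G'\<close> for \<open>G = X \<psi>\<close>,
  which vanishes unless \<open>k = n\<close> because \<open>G^(k-n-1) G'\<close> is then a derivative.\<close>

lemma fps_power_residue:
  fixes \<phi> \<psi> :: "'a::field_char_0 fps"
  assumes inv: "\<phi> * \<psi> = 1" and le: "k \<le> n"
  shows "((fps_X * \<psi>) ^ k * (fps_deriv (fps_X * \<psi>) * \<phi> ^ Suc n)) $ n = (if k = n then 1 else 0)"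
proof -
  define m where "m = n - k"
  have n: "n = k + m"
    using le by (simp add: m_def)
  \<comment> \<open>The powers of \<open>\<psi>\<close> cancel against \<open>k\<close> factors
    \<open>\<phi>\<close>. What remains is a shift by \<open>k\<close>, so only
    \<open>m = n - k\<close> matters.\<close>
  have "\<psi> ^ k * \<phi> ^ k = 1"
    by (metis inv mult.commute power_mult_distrib power_one)
  then have "\<psi> ^ k * \<phi> ^ Suc n = \<phi> ^ Suc m"
    by (simp add: n power_add mult.left_commute[of _ \<phi>] flip: mult.assoc)
  then have "(fps_X * \<psi>) ^ k * (fps_deriv (fps_X * \<psi>) * \<phi> ^ Suc n)
      = fps_X ^ k * (fps_deriv (fps_X * \<psi>) * \<phi> ^ Suc m)"
    by (simp only: power_mult_distrib mult.assoc mult.left_commute[of "\<psi> ^ k"])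
  then have shift: "((fps_X * \<psi>) ^ k * (fps_deriv (fps_X * \<psi>) * \<phi> ^ Suc n)) $ n
      = (fps_deriv (fps_X * \<psi>) * \<phi> ^ Suc m) $ m"
    by (simp only: fps_X_power_mult_nth) (simp add: n)
  have split: "fps_deriv (fps_X * \<psi>) * \<phi> ^ Suc m
      = \<phi> ^ m * (\<phi> * \<psi>) + fps_X * (\<phi> ^ Suc m * fps_deriv \<psi>)"
    by (simp add: algebra_simps)
  show ?thesis
  proof (cases m)
    case 0
    then show ?thesis
      unfolding shift split inv by (simp add: n)
  next
    case (Suc j)
    \<comment> \<open>Differentiating \<open>\<phi> * \<psi> = 1\<close> trades the derivative of
      \<open>\<psi>\<close> for that of \<open>\<phi>\<close>.\<close>
    have "fps_deriv (\<phi> * \<psi>) = 0"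
      by (simp add: inv)
    then have d: "\<phi> * fps_deriv \<psi> = - (fps_deriv \<phi> * \<psi>)"
      by (simp add: algebra_simps add_eq_0_iff)
    have "\<phi> ^ Suc m * fps_deriv \<psi> = \<phi> ^ m * (\<phi> * fps_deriv \<psi>)"
      by (simp add: algebra_simps)
    also have "\<dots> = - (fps_deriv \<phi> * \<phi> ^ j) * (\<phi> * \<psi>)"
      by (simp only: d) (simp add: Suc algebra_simps)
    finally have e: "\<phi> ^ Suc m * fps_deriv \<psi> = - (fps_deriv \<phi> * \<phi> ^ j)"
      by (simp add: inv)
    \<comment> \<open>Coefficient \<open>j = m - 1\<close> of the derivative of
      \<open>\<phi> ^ m\<close> is read in two ways; characteristic zero cancels \<open>m\<close>,
      and the two terms of \<open>split\<close> then annihilate each other.\<close>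
    have "(fps_deriv (\<phi> ^ m)) $ j = of_nat m * (fps_deriv \<phi> * \<phi> ^ j) $ j"
      by (simp only: fps_deriv_power Suc mult.assoc fps_mult_left_const_nth diff_Suc_1)
    then have "of_nat m * (\<phi> ^ m) $ m = of_nat m * (fps_deriv \<phi> * \<phi> ^ j) $ j"
      by (simp only: Suc fps_deriv_nth Suc_eq_plus1)
    then have "(\<phi> ^ m) $ m = (fps_deriv \<phi> * \<phi> ^ j) $ j"
      by (simp add: Suc del: of_nat_Suc power_Suc)
    moreover have "(fps_deriv (fps_X * \<psi>) * \<phi> ^ Suc m) $ m
        = (\<phi> ^ m) $ m - (fps_deriv \<phi> * \<phi> ^ j) $ j"
      unfolding split e inv by (simp add: Suc)
    ultimately show ?thesis
      using shift Suc n by simp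
  qed
qed

text \<open>Since \<open>b ^ i\<close> has no terms below degree \<open>i\<close>, the composition
  may be cut off at the same \<open>n\<close> for every coefficient up to \<open>n\<close>, and the
  two sums can be swapped.\<close>

lemma fps_compose_mult_nth:
  fixes a b c :: "'a::comm_ring_1 fps"
  assumes "b $ 0 = 0"
  shows "((a oo b) * c) $ n = (\<Sum>i=0..n. a $ i * (b ^ i * c) $ n)"
proof -
  have "(a oo b) $ j = (\<Sum>i=0..n. a $ i * (b ^ i) $ j)" if "j \<le> n" for j
    unfolding fps_compose_nth
    by (rule sum.mono_neutral_left)
      (use that startsby_zero_power_prefix[OF assms] in auto)
  then have "((a oo b) * c) $ n = (\<Sum>j=0..n. \<Sum>i=0..n. a $ i * (b ^ i) $ j * c $ (n - j))"
    by (simp add: fps_mult_nth sum_distrib_right)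
  also have "\<dots> = (\<Sum>i=0..n. a $ i * (b ^ i * c) $ n)"
    by (subst sum.swap) (simp add: fps_mult_nth sum_distrib_left mult.assoc)
  finally show ?thesis .
qed

text \<open>Lagrange inversion without naming the inverse of \<open>g\<close>: by the chain rule the
  left-hand side is a sum over \<open>fps_deriv a $ i\<close>, and the residue lemma keeps only
  \<open>i = n\<close>.\<close>

lemma fps_lagrange_inversion:
  fixes a g \<phi> :: "'a::field_char_0 fps"
  assumes "\<phi> * g = fps_X" and g0: "g $ 0 = 0"
  shows "(fps_deriv (a oo g) * \<phi> ^ Suc n) $ n = of_nat (Suc n) * a $ Suc n"
proof -
  define \<psi> where "\<psi> = fps_shift 1 g"
  have g: "g = fps_X * \<psi>"
    by (simp add: \<psi>_def fps_eq_iff g0)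
  have "fps_X * (\<phi> * \<psi>) = fps_X * 1"
    using assms(1) by (simp add: g algebra_simps)
  then have inv: "\<phi> * \<psi> = 1"
    by (simp only: mult_left_cancel[OF fps_X_neq_zero])
  have "(fps_deriv (a oo g) * \<phi> ^ Suc n) $ n
      = (\<Sum>i=0..n. fps_deriv a $ i * (g ^ i * (fps_deriv g * \<phi> ^ Suc n)) $ n)"
    by (simp only: fps_compose_deriv[OF g0] mult.assoc fps_compose_mult_nth[OF g0])
  also have "\<dots> = (\<Sum>i=0..n. fps_deriv a $ i * (if i = n then 1 else 0))"
    by (intro sum.cong refl) (simp only: g fps_power_residue[OF inv] atLeastAtMost_iff)
  also have "\<dots> = of_nat (Suc n) * a $ Suc n"
    by (simp add: if_distrib cong: if_cong)
  finally show ?thesis .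
qed

text \<open>Putting \<open>t = (exp (lam u) - 1) / lam\<close> makes \<open>1 + lam t\<close> equal
  to \<open>exp (lam u)\<close>, which the logarithm undoes.\<close>

lemma degenerate_exp_fps_compose:
  assumes "lam \<noteq> 0"
  shows "degenerate_exp_fps lam a oo (fps_const (1 / lam) * (fps_exp lam - 1)) = fps_exp a"
proof -
  let ?g = "fps_const (1 / lam) * (fps_exp lam - 1)"
  let ?e = "fps_exp lam - 1 :: real fps"
  have g0: "?g $ 0 = 0"
    by simp
  have eg: "(fps_const lam * fps_X) oo ?g = ?e"
  proof -
    have "(fps_const lam * fps_X) oo ?g = fps_const lam * ?g"
      by (simp add: g0 flip: fps_const_mult_apply_left)
    then show ?thesis
      using assms by (simp flip: mult.assoc)
  qed
  \<comment> \<open>Rescaling the variable reduces to \<open>exp u - 1\<close>, the compositional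
    inverse of \<open>log (1 + t)\<close>.\<close>
  have e: "?e = (fps_exp 1 - 1) oo (fps_const lam * fps_X)"
    by (simp add: fps_compose_sub_distrib)
  have "fps_ln 1 oo ?e = (fps_ln 1 oo (fps_exp 1 - 1)) oo (fps_const lam * fps_X)"
    unfolding e by (rule fps_compose_assoc) simp_all
  also have "\<dots> = fps_const lam * fps_X"
    by (simp add: fps_ln_fps_exp_inv fps_inv_fps_exp_compose)
  finally have ln: "fps_ln 1 oo ?e = fps_const lam * fps_X" .
  have "(fps_const (a / lam) * (fps_ln 1 oo (fps_const lam * fps_X))) oo ?g
      = fps_const (a / lam) * (fps_ln 1 oo (fps_const lam * fps_X) oo ?g)"
    by (simp only: fps_const_mult_apply_left)
  also have "fps_ln 1 oo (fps_const lam * fps_X) oo ?g = fps_const lam * fps_X"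
    by (subst fps_compose_assoc[symmetric]) (simp_all only: g0 eg ln, simp)
  finally have lin: "(fps_const (a / lam) * (fps_ln 1 oo (fps_const lam * fps_X))) oo ?g
      = fps_const a * fps_X"
    using assms by (simp flip: mult.assoc)
  have "degenerate_exp_fps lam a oo ?g
      = fps_exp 1 oo ((fps_const (a / lam) * (fps_ln 1 oo (fps_const lam * fps_X))) oo ?g)"
    unfolding degenerate_exp_fps_def
    by (rule fps_compose_assoc[symmetric]) simp_all
  then show ?thesis
    by (simp add: lin)
qed

text \<open>The division is exact because the denominator has subdegree 1, like
  \<open>fps_X\<close>.\<close>

lemma bernoulli_fps_mult: "fps_X / (fps_exp 1 - 1) * (fps_exp 1 - 1) = (fps_X :: real fps)"
proof (rule dvd_div_mult_self)
  have "subdegree (fps_exp 1 - 1 :: real fps) = 1"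
    by (rule subdegreeI) auto
  moreover from this have "fps_exp 1 - 1 \<noteq> (0 :: real fps)"
    by (metis subdegree_0 zero_neq_one)
  ultimately show "fps_exp 1 - 1 dvd (fps_X :: real fps)"
    by (simp add: fps_dvd_iff)
qed

lemma degenerate_ordered_bell_eq_sum:
  assumes lam: "lam \<noteq> 0"
  shows "degenerate_ordered_bell lam (Suc n) x =
    (\<Sum>l=0..n. lam ^ l * real (n choose l) * higher_bernoulli (Suc n) l
      * ordered_bell_poly (Suc n - l) x)"
proof -
  define g where "g = fps_const (1 / lam) * (fps_exp lam - 1)"
  define \<beta> where "\<beta> = (fps_X / (fps_exp 1 - 1) :: real fps)"
  \<comment> \<open>This is \<open>lam u / (exp (lam u) - 1)\<close>, that is,
    \<open>u / g(u)\<close>; the rescaling is the source of the factor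
    \<open>lam ^ l\<close>.\<close>
  define \<phi> where "\<phi> = \<beta> oo (fps_const lam * fps_X)"
  define A where "A = 1 / (2 - degenerate_exp_fps lam 1) * degenerate_exp_fps lam x"
  define F where "F = 1 / (2 - fps_exp 1) * fps_exp x"
  have g0: "g $ 0 = 0"
    by (simp add: g_def)
  have "\<phi> * (fps_exp lam - 1) = (\<beta> * (fps_exp 1 - 1)) oo (fps_const lam * fps_X)"
    by (simp add: \<phi>_def fps_compose_mult_distrib fps_compose_sub_distrib)
  then have "\<phi> * (fps_exp lam - 1) = fps_const lam * fps_X"
    by (simp add: \<beta>_def bernoulli_fps_mult)
  then have "fps_const (1 / lam) * (\<phi> * (fps_exp lam - 1)) = fps_X"
    using lam by (simp flip: mult.assoc)
  then have \<phi>g: "\<phi> * g = fps_X"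
    by (simp add: g_def mult.left_commute)
  \<comment> \<open>Hence the denominator \<open>2 - degenerate_exp_fps lam 1\<close> has constant
    term 1, and composition with \<open>g\<close> respects the quotient.\<close>
  have D0: "degenerate_exp_fps lam 1 $ 0 = 1"
    by (simp add: degenerate_exp_fps_def)
  have "A oo g = F"
    by (simp add: A_def F_def fps_compose_mult_distrib[OF g0] fps_divide_compose[OF g0] D0
        fps_compose_sub_distrib degenerate_exp_fps_compose[OF lam, folded g_def])
  then have "real (Suc n) * A $ Suc n = (fps_deriv F * \<phi> ^ Suc n) $ n"
    using fps_lagrange_inversion[OF \<phi>g g0, of A n] by simp
  also have "\<dots> = (\<Sum>l=0..n. (\<phi> ^ Suc n) $ l * fps_deriv F $ (n - l))"
    by (simp add: mult.commute[of "fps_deriv F"] fps_mult_nth del: power_Suc)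
  also have "\<dots> = (\<Sum>l=0..n. lam ^ l * (\<beta> ^ Suc n) $ l * (real (Suc n - l) * F $ (Suc n - l)))"
    by (intro sum.cong refl)
      (simp add: \<phi>_def fps_compose_power Suc_diff_le del: power_Suc)
  finally have A: "real (Suc n) * A $ Suc n
      = (\<Sum>l=0..n. lam ^ l * (\<beta> ^ Suc n) $ l * (real (Suc n - l) * F $ (Suc n - l)))" .
  have "degenerate_ordered_bell lam (Suc n) x = fact n * (real (Suc n) * A $ Suc n)"
    by (simp add: degenerate_ordered_bell_def A_def algebra_simps)
  also have "\<dots> = (\<Sum>l=0..n. lam ^ l * real (n choose l) * higher_bernoulli (Suc n) l
      * ordered_bell_poly (Suc n - l) x)"
    unfolding A sum_distrib_left
  proof (intro sum.cong refl)
    fix l assume "l \<in> {0..n}"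
    then have l: "l \<le> n"
      by simp
    \<comment> \<open>Here \<open>fact l\<close> goes to the Bernoulli number, while
      \<open>fact (n - l)\<close> and the factor \<open>Suc n - l\<close> from differentiating
      \<open>F\<close> form the factorial of the Bell polynomial.\<close>
    have "fact n = (real (n choose l) * fact l * fact (n - l))"
      using l by (simp add: binomial_fact)
    moreover have "fact (Suc n - l) = (real (Suc n - l) * fact (n - l))"
      using l by (simp add: Suc_diff_le)
    ultimately show "fact n * (lam ^ l * (\<beta> ^ Suc n) $ l * (real (Suc n - l) * F $ (Suc n - l)))
        = lam ^ l * real (n choose l) * higher_bernoulli (Suc n) l * ordered_bell_poly (Suc n - l) x"
      unfolding higher_bernoulli_def ordered_bell_poly_def \<beta>_def[symmetric] F_def[symmetric]
      by (simp only: mult_ac)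
  qed
  finally show ?thesis .
qed

lemma ordered_bell_poly_eq_sum:
  "ordered_bell_poly n x = (\<Sum>m=0..n. real (n choose m) * ordered_bell_number m * x ^ (n - m))"
proof -
  have "ordered_bell_poly n x
      = (\<Sum>m=0..n. fact n * ((1 / (2 - fps_exp 1)) $ m * (x ^ (n - m) / fact (n - m))))"
    by (simp add: ordered_bell_poly_def fps_mult_nth sum_distrib_left)
  also have "\<dots> = (\<Sum>m=0..n. real (n choose m) * ordered_bell_number m * x ^ (n - m))"
    by (intro sum.cong refl)
      (simp add: ordered_bell_number_def ordered_bell_poly_def binomial_fact)
  finally show ?thesis .
qed

theorem theorem5:
  fixes lam x :: real and n :: nat
  assumes "lam \<noteq> 0" and "n \<ge> 1"
  shows "degenerate_ordered_bell lam n x =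
           (\<Sum>l=0..n-1. lam ^ l * real ((n - 1) choose l) * higher_bernoulli n l
              * ordered_bell_poly (n - l) x)
       \<and> (\<Sum>l=0..n-1. lam ^ l * real ((n - 1) choose l) * higher_bernoulli n l
              * ordered_bell_poly (n - l) x) =
           (\<Sum>l=0..n. \<Sum>m=0..n-l. lam ^ l * real ((n - 1) choose l) * real ((n - l) choose m)
              * higher_bernoulli n l * ordered_bell_number m * x ^ (n - l - m))"
proof
  obtain k where n: "n = Suc k"
    using assms(2) by (cases n) auto
  show "degenerate_ordered_bell lam n x =
      (\<Sum>l=0..n-1. lam ^ l * real ((n - 1) choose l) * higher_bernoulli n l
        * ordered_bell_poly (n - l) x)"
    using degenerate_ordered_bell_eq_sum[OF assms(1), of k x] by (simp only: n diff_Suc_1)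
  have "(\<Sum>l=0..n. \<Sum>m=0..n-l. lam ^ l * real ((n - 1) choose l) * real ((n - l) choose m)
        * higher_bernoulli n l * ordered_bell_number m * x ^ (n - l - m))
      = (\<Sum>l=0..n. lam ^ l * real ((n - 1) choose l) * higher_bernoulli n l
        * ordered_bell_poly (n - l) x)"
    by (simp add: ordered_bell_poly_eq_sum sum_distrib_left mult_ac)
  \<comment> \<open>The extra term \<open>l = n\<close> vanishes because
    \<open>(n - 1) choose n\<close> is 0.\<close>
  also have "\<dots> = (\<Sum>l=0..n-1. lam ^ l * real ((n - 1) choose l) * higher_bernoulli n l
        * ordered_bell_poly (n - l) x)"
    by (simp add: n)
  finally show "(\<Sum>l=0..n-1. lam ^ l * real ((n - 1) choose l) * higher_bernoulli n l
        * ordered_bell_poly (n - l) x) =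
      (\<Sum>l=0..n. \<Sum>m=0..n-l. lam ^ l * real ((n - 1) choose l) * real ((n - l) choose m)
        * higher_bernoulli n l * ordered_bell_number m * x ^ (n - l - m))"
    by (rule sym)
qed

end
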